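(* Let $\gamma>0$ and $\beta\in(-1,\infty)$. Let $\mathcal{X}=\{\mathcal{X}_n\}$ be a spike prior such that each $\mathcal{X}_n$ is supported on at most $c^n$ points, for some fixed $c>0$. If $$2\gamma\log c<\beta-\log(1+\beta),$$ then there is a test that consistently distinguishes between the spiked Wishart model $\mathrm{Wish}(\gamma,\beta,\mathcal{X})$ and the unspiked model $\mathrm{Wish}(\gamma)$, i.e. a hypothesis test for which the sum of the probabilities of type I and type II error tends to $0$ as $n\to\infty$.
   Context: A spike prior is a family $\mathcal{X}=\{\mathcal{X}_n\}$, where $\mathcal{X}_n$ is a probability distribution on $\mathbb{R}^n$ such that for $x\sim\mathcal{X}_n$, $\|x\|\to1$ in probability as $n\to\infty$. Spiked Wishart model $\mathrm{Wish}(\gamma,\beta,\mathcal{X})$, for $\gamma>0$, $\beta\in[-1,\infty)$: draw $x\sim\mathcal{X}_n$ and reveal $Y=\frac1NXX^\top$, where $X$ is an $n\times N$ matrix whose columns are sampled independently from $\mathcal{N}(0,I_n+\beta xx^\top)$, and $N=N(n)$ satisfies $n/N\to\gamma$ as $n\to\infty$. If $\beta<0$ and $|\beta|\cdot\|x\|^2>1$, output instead a failure symbol $\perp$. The unspiked model $\mathrm{Wish}(\gamma)$ is the case $\beta=0$ (with the same $N$). The test need not be computationally efficient. Type I error: declaring the spiked model when the sample is from the unspiked model; type II error: the reverse. *)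

theory Defs
  imports "HOL-Probability.Probability"
begin

section \<open>Vectors and matrices of varying size\<close>

text \<open>Since the dimension tends to infinity, \<open>\<real>\<^sup>n\<close> is the product space over the index set
  \<open>{..<n}\<close>. Its norm is \<open>L2_set x {..<n}\<close>. A matrix is curried, so an element of
  \<open>mat_space n m\<close> is an \<open>n\<close>-tuple of vectors in \<open>\<real>\<^sup>m\<close>.\<close>

abbreviation vec_space :: "nat \<Rightarrow> (nat \<Rightarrow> real) measure" where
  "vec_space n \<equiv> PiM {..<n} (\<lambda>_. borel)"

abbreviation mat_space :: "nat \<Rightarrow> nat \<Rightarrow> (nat \<Rightarrow> nat \<Rightarrow> real) measure" where
  "mat_space n m \<equiv> PiM {..<n} (\<lambda>_. vec_space m)"

text \<open>For matrices that only serve as parameters, entries outside the index range are irrelevant.\<close>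

definition psd_mat :: "nat \<Rightarrow> (nat \<Rightarrow> nat \<Rightarrow> real) \<Rightarrow> bool" where
  "psd_mat n A \<longleftrightarrow> (\<forall>i<n. \<forall>j<n. A i j = A j i) \<and>
     (\<forall>u. 0 \<le> (\<Sum>i<n. \<Sum>j<n. u i * A i j * u j))"

text \<open>The positive semidefinite square root. It exists when \<open>A\<close> is positive semidefinite, and its
  entries with indices below \<open>n\<close> are then unique.\<close>

definition mat_sqrt :: "nat \<Rightarrow> (nat \<Rightarrow> nat \<Rightarrow> real) \<Rightarrow> (nat \<Rightarrow> nat \<Rightarrow> real)" where
  "mat_sqrt n A = (SOME R. psd_mat n R \<and> (\<forall>i<n. \<forall>j<n. (\<Sum>k<n. R i k * R k j) = A i j))"

section \<open>Gaussian vectors\<close>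

definition std_gaussian :: "nat \<Rightarrow> (nat \<Rightarrow> real) measure" where
  "std_gaussian n = PiM {..<n} (\<lambda>_. density lborel (\<lambda>t. ennreal (std_normal_density t)))"

text \<open>The centred Gaussian with positive semidefinite, possibly singular, covariance \<open>S\<close> is the law
  of \<open>S\<^sup>1\<^sup>/\<^sup>2 g\<close> for a standard Gaussian vector \<open>g\<close>.\<close>

definition gaussian :: "nat \<Rightarrow> (nat \<Rightarrow> nat \<Rightarrow> real) \<Rightarrow> (nat \<Rightarrow> real) measure" where
  "gaussian n S = distr (std_gaussian n) (vec_space n)
     (\<lambda>g. \<lambda>i\<in>{..<n}. \<Sum>j<n. mat_sqrt n S i j * g j)"

section \<open>Spike priors\<close>

definition spike_prior :: "(nat \<Rightarrow> (nat \<Rightarrow> real) measure) \<Rightarrow> bool" where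
  "spike_prior X \<longleftrightarrow>
     (\<forall>n. prob_space (X n) \<and> sets (X n) = sets (vec_space n)) \<and>
     (\<forall>\<epsilon>>0. (\<lambda>n. \<P>(x in X n. \<bar>L2_set x {..<n} - 1\<bar> > \<epsilon>)) \<longlonglongrightarrow> 0)"

definition supported_on_at_most :: "(nat \<Rightarrow> real) measure \<Rightarrow> real \<Rightarrow> bool" where
  "supported_on_at_most P k \<longleftrightarrow> (\<exists>A. finite A \<and> real (card A) \<le> k \<and> (AE x in P. x \<in> A))"

section \<open>The spiked Wishart model\<close>

text \<open>The space of outcomes: a matrix or the failure symbol, represented by \<open>None\<close>, which forms
  an isolated measurable atom.\<close>

definition option_measure :: "'a measure \<Rightarrow> 'a option measure" where
  "option_measure M = sigma (insert None (Some ` space M))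
     {A. A \<subseteq> insert None (Some ` space M) \<and> Some -` A \<inter> space M \<in> sets M}"

abbreviation outcome_space :: "nat \<Rightarrow> (nat \<Rightarrow> nat \<Rightarrow> real) option measure" where
  "outcome_space n \<equiv> option_measure (mat_space n n)"

definition spiked_cov :: "real \<Rightarrow> (nat \<Rightarrow> real) \<Rightarrow> nat \<Rightarrow> nat \<Rightarrow> real" where
  "spiked_cov \<beta> x i j = (if i = j then 1 else 0) + \<beta> * x i * x j"

text \<open>The argument \<open>X\<close> is the family of columns: \<open>X j i\<close> is the entry in row \<open>i\<close>, column \<open>j\<close>.\<close>

definition sample_cov :: "nat \<Rightarrow> nat \<Rightarrow> (nat \<Rightarrow> nat \<Rightarrow> real) \<Rightarrow> (nat \<Rightarrow> nat \<Rightarrow> real)" where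
  "sample_cov n N X = (\<lambda>i\<in>{..<n}. \<lambda>k\<in>{..<n}. 1 / real N * (\<Sum>j<N. X j i * X j k))"

definition wishart_given_spike ::
    "nat \<Rightarrow> nat \<Rightarrow> real \<Rightarrow> (nat \<Rightarrow> real) \<Rightarrow> (nat \<Rightarrow> nat \<Rightarrow> real) option measure" where
  "wishart_given_spike n N \<beta> x =
     (if \<beta> < 0 \<and> \<bar>\<beta>\<bar> * (L2_set x {..<n})\<^sup>2 > 1 then return (outcome_space n) None
      else distr (PiM {..<N} (\<lambda>_. gaussian n (spiked_cov \<beta> x))) (outcome_space n)
             (\<lambda>X. Some (sample_cov n N X)))"

definition spiked_wishart ::
    "nat \<Rightarrow> nat \<Rightarrow> real \<Rightarrow> (nat \<Rightarrow> real) measure \<Rightarrow> (nat \<Rightarrow> nat \<Rightarrow> real) option measure" where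
  "spiked_wishart n N \<beta> P = P \<bind> wishart_given_spike n N \<beta>"

text \<open>For \<open>\<beta> = 0\<close> the spike has no influence, so it is set to zero here; see
  \<open>spiked_wishart_zero\<close> below.\<close>

definition unspiked_wishart :: "nat \<Rightarrow> nat \<Rightarrow> (nat \<Rightarrow> nat \<Rightarrow> real) option measure" where
  "unspiked_wishart n N = wishart_given_spike n N 0 (\<lambda>_. 0)"

section \<open>Consistent tests\<close>

text \<open>The spiked model \<open>P\<close> and the unspiked model \<open>Q\<close> are sequences of laws on \<open>M n\<close>;
  \<open>T n y = True\<close> means that the test declares \<open>P\<close> upon seeing \<open>y\<close>. The two summands are the
  probabilities of type I and type II error.\<close>

definition consistently_distinguishes ::
    "(nat \<Rightarrow> 'a measure) \<Rightarrow> (nat \<Rightarrow> 'a \<Rightarrow> bool) \<Rightarrow> (nat \<Rightarrow> 'a measure) \<Rightarrow> (nat \<Rightarrow> 'a measure) \<Rightarrow> bool" where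
  "consistently_distinguishes M T P Q \<longleftrightarrow>
     (\<forall>n. T n \<in> measurable (M n) (count_space UNIV)) \<and>
     (\<lambda>n. \<P>(y in Q n. T n y) + \<P>(y in P n. \<not> T n y)) \<longlonglongrightarrow> 0"

section \<open>Well-definedness\<close>

text \<open>The outcome space has the intended measurable sets, the conditional law is a Markov kernel,
  so that the monadic bind in \<open>spiked_wishart\<close> is the mixture over the prior, and
  the unspiked model is the case \<open>\<beta> = 0\<close>. The main point is the uniqueness of the square root
  of \<open>I + \<beta> x x\<^sup>T\<close>.\<close>

lemma option_measure_sigma_algebra:
  "sigma_algebra (insert None (Some ` space M))
     {A. A \<subseteq> insert None (Some ` space M) \<and> Some -` A \<inter> space M \<in> sets M}"
proof (rule sigma_algebra_iff2[THEN iffD2], intro conjI)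
  show "\<forall>s\<in>{A. A \<subseteq> insert None (Some ` space M) \<and> Some -` A \<inter> space M \<in> sets M}.
     insert None (Some ` space M) - s \<in> {A. A \<subseteq> insert None (Some ` space M) \<and> Some -` A \<inter> space M \<in> sets M}"
  proof safe
    fix s assume *: "Some -` s \<inter> space M \<in> sets M"
    have "Some -` (insert None (Some ` space M) - s) \<inter> space M = space M - (Some -` s \<inter> space M)"
      by auto
    with * show "Some -` (insert None (Some ` space M) - s) \<inter> space M \<in> sets M" by auto
  qed
  show "\<forall>A. range A \<subseteq> {A. A \<subseteq> insert None (Some ` space M) \<and> Some -` A \<inter> space M \<in> sets M} \<longrightarrow>
      (\<Union>i::nat. A i) \<in> {A. A \<subseteq> insert None (Some ` space M) \<and> Some -` A \<inter> space M \<in> sets M}"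
  proof (intro allI impI)
    fix A :: "nat \<Rightarrow> 'a option set"
    assume *: "range A \<subseteq> {A. A \<subseteq> insert None (Some ` space M) \<and> Some -` A \<inter> space M \<in> sets M}"
    have "Some -` (\<Union>i. A i) \<inter> space M = (\<Union>i. Some -` A i \<inter> space M)" by auto
    moreover have "\<dots> \<in> sets M" using * by (intro sets.countable_UN) auto
    ultimately show "(\<Union>i. A i) \<in> {A. A \<subseteq> insert None (Some ` space M) \<and> Some -` A \<inter> space M \<in> sets M}"
      using * by auto
  qed
qed auto

lemma space_option_measure [simp]: "space (option_measure M) = insert None (Some ` space M)"
  unfolding option_measure_def by (rule space_measure_of) auto

lemma sets_option_measure:
  "sets (option_measure M) =
     {A. A \<subseteq> insert None (Some ` space M) \<and> Some -` A \<inter> space M \<in> sets M}"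
  unfolding option_measure_def
  by (rule sigma_algebra.sets_measure_of_eq[OF option_measure_sigma_algebra])

lemma measurable_Some_option_measure [measurable]: "Some \<in> measurable M (option_measure M)"
  by (rule measurableI) (auto simp: sets_option_measure)

lemma sets_std_gaussian [measurable_cong]: "sets (std_gaussian n) = sets (vec_space n)"
  unfolding std_gaussian_def by (intro sets_PiM_cong) auto

lemma prob_space_std_gaussian: "prob_space (std_gaussian n)"
  unfolding std_gaussian_def by (intro prob_space_PiM prob_space_normal_density) auto

lemma sets_gaussian [measurable_cong]: "sets (gaussian n S) = sets (vec_space n)"
  by (simp add: gaussian_def)

lemma measurable_lin [measurable]:
  "(\<lambda>g. \<lambda>i\<in>{..<n}. \<Sum>j<n. R i j * g j) \<in> measurable (vec_space n) (vec_space n)"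
  by (intro measurable_restrict) (auto intro!: borel_measurable_sum borel_measurable_times)

lemma prob_space_gaussian: "prob_space (gaussian n S)"
  unfolding gaussian_def
  by (rule prob_space.prob_space_distr[OF prob_space_std_gaussian]) measurable

lemma measurable_sample_cov [measurable]: "sample_cov n N \<in> measurable (mat_space N n) (mat_space n n)"
  unfolding sample_cov_def
proof (intro measurable_restrict)
  fix i k assume "i \<in> {..<n}" "k \<in> {..<n}"
  then have "(\<lambda>X. X j l) \<in> borel_measurable (mat_space N n)" if "j < N" "l \<in> {i, k}" for j l
    using that
    by (intro measurable_compose[OF measurable_component_singleton[of j] measurable_component_singleton[of l]])
       auto
  then show "(\<lambda>X. 1 / real N * (\<Sum>j<N. X j i * X j k)) \<in> borel_measurable (mat_space N n)"
    by (intro borel_measurable_times borel_measurable_const borel_measurable_sum) auto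
qed


text \<open>The positive semidefinite square root of \<open>I + \<beta> x x\<^sup>T\<close>; for \<open>x = 0\<close> division by zero
  makes the coefficient vanish.\<close>

definition spiked_sqrt :: "nat \<Rightarrow> real \<Rightarrow> (nat \<Rightarrow> real) \<Rightarrow> nat \<Rightarrow> nat \<Rightarrow> real" where
  "spiked_sqrt n \<beta> x =
     spiked_cov ((sqrt (1 + \<beta> * (L2_set x {..<n})\<^sup>2) - 1) / (L2_set x {..<n})\<^sup>2) x"

definition dotp :: "nat \<Rightarrow> (nat \<Rightarrow> real) \<Rightarrow> (nat \<Rightarrow> real) \<Rightarrow> real" where
  "dotp n u v = (\<Sum>i<n. u i * v i)"

definition mat_app :: "nat \<Rightarrow> (nat \<Rightarrow> nat \<Rightarrow> real) \<Rightarrow> (nat \<Rightarrow> real) \<Rightarrow> nat \<Rightarrow> real" where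
  "mat_app n R v = (\<lambda>i. \<Sum>j<n. R i j * v j)"

lemma dotp_L2: "dotp n x x = (L2_set x {..<n})\<^sup>2"
  by (simp add: dotp_def L2_set_def sum_nonneg power2_eq_square)

lemma psd_mat_iff: "psd_mat n R \<longleftrightarrow>
    (\<forall>i<n. \<forall>j<n. R i j = R j i) \<and> (\<forall>u. 0 \<le> dotp n u (mat_app n R u))"
  by (simp add: psd_mat_def dotp_def mat_app_def sum_distrib_left mult.assoc)

lemma dotp_sym:
  assumes "psd_mat n R"
  shows "dotp n u (mat_app n R v) = dotp n (mat_app n R u) v"
proof -
  have "dotp n u (mat_app n R v) = (\<Sum>i<n. \<Sum>j<n. u i * R i j * v j)"
    by (simp add: dotp_def mat_app_def sum_distrib_left mult.assoc)
  also have "\<dots> = (\<Sum>j<n. \<Sum>i<n. u i * R i j * v j)" by (rule sum.swap)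
  also have "\<dots> = (\<Sum>j<n. \<Sum>i<n. R j i * u i * v j)"
    using assms by (intro sum.cong refl) (auto simp: psd_mat_iff)
  finally show ?thesis by (simp add: dotp_def mat_app_def sum_distrib_right)
qed

lemma dotp_add: "dotp n u (\<lambda>i. v i + c * w i) = dotp n u v + c * dotp n u w"
  by (simp add: dotp_def sum.distrib sum_distrib_left algebra_simps)

lemma dotp_add_left: "dotp n (\<lambda>i. v i + c * w i) u = dotp n v u + c * dotp n w u"
  by (simp add: dotp_def sum.distrib sum_distrib_left algebra_simps)

lemma dotp_commute: "dotp n u v = dotp n v u"
  by (simp add: dotp_def mult.commute)

lemma mat_app_add: "mat_app n R (\<lambda>i. v i + c * w i) = (\<lambda>i. mat_app n R v i + c * mat_app n R w i)"
  by (simp add: mat_app_def sum.distrib sum_distrib_left algebra_simps fun_eq_iff)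

lemma mat_app_cong: "(\<And>i. i < n \<Longrightarrow> v i = w i) \<Longrightarrow> mat_app n R v = mat_app n R w"
  by (simp add: mat_app_def fun_eq_iff)

lemma mat_app_spiked_cov: "i < n \<Longrightarrow> mat_app n (spiked_cov a x) v i = v i + a * dotp n x v * x i"
  by (simp add: mat_app_def spiked_cov_def dotp_def sum.distrib algebra_simps sum_distrib_left
      if_distrib[of "\<lambda>c. _ * c"] cong: if_cong)

lemma dotp_self_eq_0: "dotp n z z = 0 \<Longrightarrow> i < n \<Longrightarrow> z i = 0"
  by (simp add: dotp_def sum_nonneg_eq_0_iff)

lemma dotp_self_nonneg: "0 \<le> dotp n z z"
  by (simp add: dotp_def sum_nonneg)

lemma dotp_zero_left: "(\<And>i. i < n \<Longrightarrow> u i = 0) \<Longrightarrow> dotp n u v = 0"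
  by (simp add: dotp_def)

lemma dotp_Cauchy_Schwarz: "(dotp n u v)\<^sup>2 \<le> dotp n u u * dotp n v v"
  using Cauchy_Schwarz_ineq_sum[of u v "{..<n}"] by (simp add: dotp_def power2_eq_square)

lemma psd_mat_null:
  assumes "psd_mat n R" "dotp n z (mat_app n R z) = 0" "i < n"
  shows "mat_app n R z i = 0"
proof -
  define w where "w = mat_app n R z"
  define c where "c = dotp n w (mat_app n R w)"
  define p where "p = dotp n w w"
  have "c \<ge> 0" using assms(1) by (simp add: c_def psd_mat_iff)
  have *: "0 \<le> 2 * t * p + t\<^sup>2 * c" for t
  proof -
    have "0 \<le> dotp n (\<lambda>i. z i + t * w i) (mat_app n R (\<lambda>i. z i + t * w i))"
      using assms(1) by (simp add: psd_mat_iff)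
    also have "\<dots> = 2 * t * p + t\<^sup>2 * c"
      using assms(2) dotp_sym[OF assms(1), of z w]
      by (simp add: mat_app_add dotp_add dotp_add_left p_def c_def power2_eq_square algebra_simps
          flip: w_def)
    finally show ?thesis .
  qed
  have "p \<ge> 0" by (simp add: p_def dotp_self_nonneg)
  have "p = 0"
  proof (rule ccontr)
    assume "p \<noteq> 0"
    with \<open>p \<ge> 0\<close> have "p > 0" by simp
    define s where "s = p / (c + 1)"
    have p: "p = s * (c + 1)" and "s > 0" using \<open>c \<ge> 0\<close> \<open>p > 0\<close> by (simp_all add: s_def)
    have "0 \<le> 2 * (- s) * p + (- s)\<^sup>2 * c" by (rule *)
    also have "\<dots> = - (s\<^sup>2 * (c + 2))"
      by (simp add: p algebra_simps power2_eq_square)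
    also have "\<dots> < 0" using \<open>c \<ge> 0\<close> \<open>s > 0\<close> by simp
    finally show False by simp
  qed
  then show ?thesis using assms(3) dotp_self_eq_0 by (simp add: p_def w_def)
qed

lemma psd_spiked_sqrt:
  assumes "0 \<le> 1 + \<beta> * (L2_set x {..<n})\<^sup>2"
  shows "psd_mat n (spiked_sqrt n \<beta> x)"
  unfolding psd_mat_iff
proof (intro conjI allI impI)
  fix u
  define q where "q = (L2_set x {..<n})\<^sup>2"
  define r where "r = sqrt (1 + \<beta> * q)"
  define a where "a = (r - 1) / q"
  have "r \<ge> 0" using assms by (simp add: r_def q_def)
  have "q \<ge> 0" by (simp add: q_def)
  have "mat_app n (spiked_sqrt n \<beta> x) u i = u i + a * dotp n x u * x i" if "i < n" for i
    unfolding spiked_sqrt_def using that by (simp add: mat_app_spiked_cov a_def r_def q_def)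
  then have "dotp n u (mat_app n (spiked_sqrt n \<beta> x) u) = dotp n u (\<lambda>i. u i + a * dotp n x u * x i)"
    by (simp add: dotp_def)
  also have "\<dots> = dotp n u u + a * (dotp n u x)\<^sup>2"
    by (simp add: dotp_add dotp_commute[of n x u] power2_eq_square)
  also have "\<dots> \<ge> 0"
  proof (cases "a \<ge> 0")
    case False
    have "a * (dotp n u x)\<^sup>2 \<ge> a * (dotp n u u * q)"
      using False dotp_Cauchy_Schwarz[of n u x] by (simp add: mult_left_mono_neg dotp_L2[of n x] q_def)
    moreover have "a * q \<ge> -1" using \<open>r \<ge> 0\<close> by (simp add: a_def)
    then have "dotp n u u * (a * q) \<ge> dotp n u u * (-1)"
      by (intro mult_left_mono) (simp_all add: dotp_self_nonneg)
    ultimately show ?thesis by (simp add: algebra_simps)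
  qed (simp add: dotp_self_nonneg)
  finally show "0 \<le> dotp n u (mat_app n (spiked_sqrt n \<beta> x) u)" .
qed (auto simp: spiked_sqrt_def spiked_cov_def)

lemma mat_app_square:
  assumes "\<forall>i<n. \<forall>j<n. (\<Sum>k<n. R i k * R k j) = A i j" "i < n"
  shows "mat_app n R (mat_app n R v) i = mat_app n A v i"
proof -
  have "mat_app n R (mat_app n R v) i = (\<Sum>k<n. \<Sum>j<n. R i k * R k j * v j)"
    by (simp add: mat_app_def sum_distrib_left mult.assoc)
  also have "\<dots> = (\<Sum>j<n. \<Sum>k<n. R i k * R k j * v j)" by (rule sum.swap)
  also have "\<dots> = mat_app n A v i"
    using assms by (simp add: mat_app_def flip: sum_distrib_right)
  finally show ?thesis .
qed

lemma mat_app_unit: "j < n \<Longrightarrow> mat_app n R (\<lambda>i. if i = j then 1 else 0) = (\<lambda>i. R i j)"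
  by (simp add: mat_app_def fun_eq_iff if_distrib[of "\<lambda>c. _ * c"] cong: if_cong)

lemma spiked_sqrt_square:
  assumes "0 \<le> 1 + \<beta> * (L2_set x {..<n})\<^sup>2" "i < n"
  shows "mat_app n (spiked_sqrt n \<beta> x) (mat_app n (spiked_sqrt n \<beta> x) v) i
       = mat_app n (spiked_cov \<beta> x) v i"
proof -
  define q where "q = (L2_set x {..<n})\<^sup>2"
  define r where "r = sqrt (1 + \<beta> * q)"
  define a where "a = (r - 1) / q"
  have S: "mat_app n (spiked_sqrt n \<beta> x) u i = u i + a * dotp n x u * x i" if "i < n" for i u
    unfolding spiked_sqrt_def using that by (simp add: mat_app_spiked_cov a_def r_def q_def)
  have "dotp n x (mat_app n (spiked_sqrt n \<beta> x) v) = dotp n x (\<lambda>i. v i + a * dotp n x v * x i)"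
    by (simp add: dotp_def S)
  also have "\<dots> = dotp n x v + a * dotp n x v * q"
    by (simp add: dotp_add dotp_L2 q_def)
  finally have *: "mat_app n (spiked_sqrt n \<beta> x) (mat_app n (spiked_sqrt n \<beta> x) v) i
      = v i + (2 * a + a\<^sup>2 * q) * dotp n x v * x i"
    using assms(2) by (simp add: S algebra_simps power2_eq_square)
  show ?thesis
  proof (cases "q = 0")
    case True
    then have "x i = 0" using assms(2) dotp_self_eq_0[of n x i] by (simp add: dotp_L2 q_def)
    then show ?thesis using * assms(2) by (simp add: mat_app_spiked_cov)
  next
    case False
    have "r\<^sup>2 = 1 + \<beta> * q" using assms(1) by (simp add: r_def q_def)
    then have "2 * a + a\<^sup>2 * q = \<beta>"
      using False by (simp add: a_def field_simps power2_eq_square)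
    then show ?thesis using * assms(2) by (simp add: mat_app_spiked_cov)
  qed
qed

lemma spiked_sqrt_unique:
  assumes nonneg: "0 \<le> 1 + \<beta> * (L2_set x {..<n})\<^sup>2"
    and R: "psd_mat n R" "\<forall>i<n. \<forall>j<n. (\<Sum>k<n. R i k * R k j) = spiked_cov \<beta> x i j"
    and ij: "i < n" "j < n"
  shows "R i j = spiked_sqrt n \<beta> x i j"
proof -
  define S where "S = spiked_sqrt n \<beta> x"
  define a where "a = (sqrt (1 + \<beta> * (L2_set x {..<n})\<^sup>2) - 1) / (L2_set x {..<n})\<^sup>2"
  have psdS: "psd_mat n S" using psd_spiked_sqrt[OF nonneg] by (simp add: S_def)
  have appS: "mat_app n S u i = u i + a * dotp n x u * x i" if "i < n" for i u
    unfolding S_def spiked_sqrt_def using that by (simp add: mat_app_spiked_cov a_def)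
  have R2: "mat_app n R (mat_app n R u) i = u i + \<beta> * dotp n x u * x i" if "i < n" for i u
    using mat_app_square[OF R(2) that] that by (simp add: mat_app_spiked_cov)
  have S2: "mat_app n S (mat_app n S u) i = u i + \<beta> * dotp n x u * x i" if "i < n" for i u
    using spiked_sqrt_square[OF nonneg that] that by (simp add: mat_app_spiked_cov S_def)
  have comm\<beta>: "\<beta> * dotp n x u * mat_app n R x i = \<beta> * dotp n x (mat_app n R u) * x i"
    if "i < n" for i u
  proof -
    have "mat_app n R (mat_app n R (mat_app n R u)) i = mat_app n R (\<lambda>i. u i + \<beta> * dotp n x u * x i) i"
      by (rule fun_cong[OF mat_app_cong]) (simp add: R2)
    then show ?thesis using R2[OF that, of "mat_app n R u"] by (auto simp: mat_app_add)
  qed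
  have comma: "a * dotp n x u * mat_app n R x i = a * dotp n x (mat_app n R u) * x i"
    if "i < n" for i u
    using comm\<beta>[OF that, of u] by (cases "\<beta> = 0") (simp_all add: a_def)
  have comm: "mat_app n R (mat_app n S u) i = mat_app n S (mat_app n R u) i" if "i < n" for i u
  proof -
    have "mat_app n R (mat_app n S u) i = mat_app n R (\<lambda>i. u i + a * dotp n x u * x i) i"
      by (rule fun_cong[OF mat_app_cong]) (simp add: appS)
    then show ?thesis using that comma[OF that, of u] by (simp add: mat_app_add appS)
  qed
  define v :: "nat \<Rightarrow> real" where "v = (\<lambda>i. if i = j then 1 else 0)"
  define z where "z = (\<lambda>i. mat_app n R v i + (-1) * mat_app n S v i)"
  have sum0: "mat_app n R z i + 1 * mat_app n S z i = 0" if "i < n" for i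
    unfolding z_def mat_app_add using comm[OF that, of v] that by (simp add: R2 S2)
  have "dotp n z (\<lambda>i. mat_app n R z i + 1 * mat_app n S z i) = 0"
    unfolding dotp_def using sum0 by simp
  then have "dotp n z (mat_app n R z) + dotp n z (mat_app n S z) = 0"
    by (simp only: dotp_add)
  moreover have "dotp n z (mat_app n R z) \<ge> 0" "dotp n z (mat_app n S z) \<ge> 0"
    using R(1) psdS by (simp_all add: psd_mat_iff)
  ultimately have "dotp n z (mat_app n R z) = 0" "dotp n z (mat_app n S z) = 0" by linarith+
  then have "mat_app n R z i = 0" "mat_app n S z i = 0" if "i < n" for i
    using psd_mat_null R(1) psdS that by blast+
  then have "dotp n (mat_app n R z) v = 0" "dotp n (mat_app n S z) v = 0"
    by (simp_all add: dotp_zero_left)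
  moreover have "dotp n z z = dotp n z (mat_app n R v) + (-1) * dotp n z (mat_app n S v)"
    by (subst (2) z_def) (rule dotp_add)
  ultimately have "dotp n z z = 0"
    by (simp add: dotp_sym[OF R(1)] dotp_sym[OF psdS])
  then have "z i = 0" using ij(1) by (rule dotp_self_eq_0)
  then show ?thesis using ij by (simp add: z_def v_def mat_app_unit S_def)
qed

lemma mat_sqrt_spiked_cov:
  assumes "0 \<le> 1 + \<beta> * (L2_set x {..<n})\<^sup>2" "i < n" "j < n"
  shows "mat_sqrt n (spiked_cov \<beta> x) i j = spiked_sqrt n \<beta> x i j"
proof -
  let ?P = "\<lambda>R. psd_mat n R \<and> (\<forall>i<n. \<forall>j<n. (\<Sum>k<n. R i k * R k j) = spiked_cov \<beta> x i j)"
  have "(\<Sum>k<n. spiked_sqrt n \<beta> x i k * spiked_sqrt n \<beta> x k j) = spiked_cov \<beta> x i j"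
    if "i < n" "j < n" for i j
    using spiked_sqrt_square[OF assms(1) that(1), of "\<lambda>i. if i = j then 1 else 0"] that
    by (simp add: mat_app_unit) (simp add: mat_app_def)
  then have "?P (spiked_sqrt n \<beta> x)" using psd_spiked_sqrt[OF assms(1)] by blast
  then have "?P (mat_sqrt n (spiked_cov \<beta> x))" unfolding mat_sqrt_def by (rule someI[of ?P])
  then show ?thesis using spiked_sqrt_unique[OF assms(1)] assms by blast
qed

lemma gaussian_spiked_cov:
  assumes "0 \<le> 1 + \<beta> * (L2_set x {..<n})\<^sup>2"
  shows "gaussian n (spiked_cov \<beta> x) = distr (std_gaussian n) (vec_space n)
     (\<lambda>g. \<lambda>i\<in>{..<n}. \<Sum>j<n. spiked_sqrt n \<beta> x i j * g j)"
  unfolding gaussian_def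
  by (intro distr_cong refl ext restrict_ext sum.cong) (simp add: mat_sqrt_spiked_cov[OF assms])

lemma PiM_gaussian_spiked_cov:
  assumes "0 \<le> 1 + \<beta> * (L2_set x {..<n})\<^sup>2"
  shows "PiM {..<N} (\<lambda>_. gaussian n (spiked_cov \<beta> x)) =
    distr (PiM {..<N} (\<lambda>_. std_gaussian n)) (mat_space N n)
      (\<lambda>G. \<lambda>k\<in>{..<N}. \<lambda>i\<in>{..<n}. \<Sum>j<n. spiked_sqrt n \<beta> x i j * G k j)"
proof -
  let ?f = "\<lambda>g. \<lambda>i\<in>{..<n}. \<Sum>j<n. spiked_sqrt n \<beta> x i j * g j"
  let ?M = "gaussian n (spiked_cov \<beta> x)"
  have f: "?f \<in> measurable (std_gaussian n) ?M"
    by measurable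
  have "distr (PiM {..<N} (\<lambda>_. std_gaussian n)) (PiM {..<N} (\<lambda>_. ?M)) (compose {..<N} ?f)
      = PiM {..<N} (\<lambda>_. distr (std_gaussian n) ?M ?f)"
    by (rule distr_PiM_finite_prob_space') (auto intro: prob_space_std_gaussian prob_space_gaussian f)
  also have "distr (std_gaussian n) ?M ?f = ?M"
    unfolding gaussian_spiked_cov[OF assms] by (rule distr_cong) auto
  finally have "PiM {..<N} (\<lambda>_. ?M) =
      distr (PiM {..<N} (\<lambda>_. std_gaussian n)) (PiM {..<N} (\<lambda>_. ?M)) (compose {..<N} ?f)" ..
  also have "\<dots> = distr (PiM {..<N} (\<lambda>_. std_gaussian n)) (mat_space N n) (compose {..<N} ?f)"
    by (intro distr_cong refl sets_PiM_cong) (simp add: sets_gaussian)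
  finally show ?thesis by (simp add: compose_def[abs_def])
qed

lemma wishart_given_spike_eq:
  "wishart_given_spike n N \<beta> x =
     (if \<beta> < 0 \<and> \<bar>\<beta>\<bar> * (L2_set x {..<n})\<^sup>2 > 1 then return (outcome_space n) None
      else distr (PiM {..<N} (\<lambda>_. std_gaussian n)) (outcome_space n)
             (\<lambda>G. Some (sample_cov n N (\<lambda>k\<in>{..<N}. \<lambda>i\<in>{..<n}. \<Sum>j<n. spiked_sqrt n \<beta> x i j * G k j))))"
proof (cases "\<beta> < 0 \<and> \<bar>\<beta>\<bar> * (L2_set x {..<n})\<^sup>2 > 1")
  case False
  then have nonneg: "0 \<le> 1 + \<beta> * (L2_set x {..<n})\<^sup>2"
    by (cases "\<beta> < 0") (auto simp: add_nonneg_nonneg)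
  have m: "(\<lambda>G. \<lambda>k\<in>{..<N}. \<lambda>i\<in>{..<n}. \<Sum>j<n. spiked_sqrt n \<beta> x i j * G k j)
      \<in> measurable (PiM {..<N} (\<lambda>_. std_gaussian n)) (mat_space N n)"
  proof (rule measurable_restrict)
    fix k assume "k \<in> {..<N}"
    then show "(\<lambda>G. \<lambda>i\<in>{..<n}. \<Sum>j<n. spiked_sqrt n \<beta> x i j * G k j)
        \<in> measurable (PiM {..<N} (\<lambda>_. std_gaussian n)) (vec_space n)"
      by measurable
  qed
  show ?thesis
    unfolding wishart_given_spike_def PiM_gaussian_spiked_cov[OF nonneg] if_not_P[OF False]
    by (simp add: distr_distr m comp_def)
next
  case True
  show ?thesis unfolding wishart_given_spike_def if_P[OF True] ..
qed

lemma measurable_wishart_given_spike [measurable]: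
  "wishart_given_spike n N \<beta> \<in> measurable (vec_space n) (prob_algebra (outcome_space n))"
proof -
  let ?G = "PiM {..<N} (\<lambda>_. std_gaussian n)"
  have G: "?G \<in> space (prob_algebra (mat_space N n))"
    unfolding space_prob_algebra
    by (auto intro!: prob_space_PiM prob_space_std_gaussian sets_PiM_cong simp: sets_std_gaussian)
  have comp: "(\<lambda>x. x i) \<in> borel_measurable (vec_space n)" if "i < n" for i
    using that by (intro measurable_component_singleton) auto
  have norm [measurable]: "(\<lambda>x. (L2_set x {..<n})\<^sup>2) \<in> borel_measurable (vec_space n)"
    unfolding dotp_L2[symmetric] dotp_def
    by (intro borel_measurable_sum borel_measurable_times comp) auto
  have sq: "(\<lambda>x. spiked_sqrt n \<beta> x i j) \<in> borel_measurable (vec_space n)" if "i < n" "j < n" for i j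
  proof -
    note comp[OF that(1), measurable] comp[OF that(2), measurable]
    show ?thesis unfolding spiked_sqrt_def spiked_cov_def by measurable
  qed
  have lin: "(\<lambda>(x, G). \<lambda>k\<in>{..<N}. \<lambda>i\<in>{..<n}. \<Sum>j<n. spiked_sqrt n \<beta> x i j * G k j)
      \<in> measurable (vec_space n \<Otimes>\<^sub>M mat_space N n) (mat_space N n)"
    unfolding split_beta
  proof (intro measurable_restrict borel_measurable_sum borel_measurable_times)
    fix k i j assume "k \<in> {..<N}" "i \<in> {..<n}" "j \<in> {..<n}"
    then show "(\<lambda>p. spiked_sqrt n \<beta> (fst p) i j) \<in> borel_measurable (vec_space n \<Otimes>\<^sub>M mat_space N n)"
      by (intro measurable_compose[OF measurable_fst sq]) auto
    show "(\<lambda>p. snd p k j) \<in> borel_measurable (vec_space n \<Otimes>\<^sub>M mat_space N n)"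
      using \<open>k \<in> {..<N}\<close> \<open>j \<in> {..<n}\<close>
      by (intro measurable_compose[OF measurable_snd
            measurable_compose[OF measurable_component_singleton[of k] measurable_component_singleton[of j]]])
  qed
  have "(\<lambda>x. distr ?G (outcome_space n)
             (\<lambda>G. Some (sample_cov n N (\<lambda>k\<in>{..<N}. \<lambda>i\<in>{..<n}. \<Sum>j<n. spiked_sqrt n \<beta> x i j * G k j))))
      \<in> measurable (vec_space n) (prob_algebra (outcome_space n))"
  proof (rule measurable_distr_prob_space2[where M = "mat_space N n"])
    show "(\<lambda>x. ?G) \<in> measurable (vec_space n) (prob_algebra (mat_space N n))"
      using G by simp
    show "(\<lambda>(x, G). Some (sample_cov n N (\<lambda>k\<in>{..<N}. \<lambda>i\<in>{..<n}. \<Sum>j<n. spiked_sqrt n \<beta> x i j * G k j)))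
      \<in> measurable (vec_space n \<Otimes>\<^sub>M mat_space N n) (outcome_space n)"
      using measurable_compose[OF measurable_compose[OF lin measurable_sample_cov]
          measurable_Some_option_measure]
      by (simp add: split_beta)
  qed
  moreover have "return (outcome_space n) None \<in> space (prob_algebra (outcome_space n))"
    by (auto simp: space_prob_algebra intro!: prob_space_return)
  ultimately show ?thesis
    unfolding wishart_given_spike_eq[abs_def]
    by (intro measurable_If) (simp_all, measurable)
qed

lemma spiked_wishart_in_prob_algebra:
  assumes "prob_space P" "sets P = sets (vec_space n)"
  shows "spiked_wishart n N \<beta> P \<in> space (prob_algebra (outcome_space n))"
proof -
  have P: "P \<in> space (prob_algebra (vec_space n))"
    using assms by (simp add: space_prob_algebra)
  have "(\<lambda>_. P \<bind> wishart_given_spike n N \<beta>)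
      \<in> measurable (count_space UNIV :: unit measure) (prob_algebra (outcome_space n))"
    by (rule measurable_bind_prob_space[OF _ measurable_wishart_given_spike]) (use P in simp)
  from measurable_space[OF this] show ?thesis by (simp add: spiked_wishart_def)
qed

lemma spiked_wishart_zero:
  assumes "prob_space P"
  shows "spiked_wishart n N 0 P = unspiked_wishart n N"
proof -
  have eq: "wishart_given_spike n N 0 = (\<lambda>_. unspiked_wishart n N)"
    by (simp add: unspiked_wishart_def wishart_given_spike_def spiked_cov_def[abs_def] fun_eq_iff)
  have "unspiked_wishart n N \<in> space (prob_algebra (outcome_space n))"
    using measurable_space[OF measurable_wishart_given_spike, of "\<lambda>i\<in>{..<n}. 0" n N 0]
    by (simp add: eq space_PiM)
  then have "prob_space (unspiked_wishart n N)" by (simp add: space_prob_algebra)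
  then show ?thesis
    unfolding spiked_wishart_def eq
    by (intro bind_const' assms prob_space_imp_subprob_space)
qed

end

theory Submission
  imports Defs
begin

text \<open>The test scans the support of the prior for a direction \<open>v\<close> in which \<open>v\<^sup>T Y v\<close> exceeds (for
  \<open>\<beta> > 0\<close>) or falls below (for \<open>\<beta> < 0\<close>) the level \<open>t \<parallel>v\<parallel>\<^sup>2\<close>, where \<open>t\<close> lies strictly between \<open>1\<close>
  and \<open>1 + \<beta>\<close>. In the unspiked model \<open>v\<^sup>T Y v / \<parallel>v\<parallel>\<^sup>2\<close> is \<open>\<chi>\<^sup>2\<^sub>N / N\<close>, and a Chernoff bound gives
  probability at most \<open>exp (- N/2 (t - 1 - ln t))\<close> per direction. Since \<open>n / N \<longlonglongrightarrow> \<gamma>\<close>, this beats the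
  number \<open>c\<^sup>n\<close> of directions once \<open>t\<close> is close to \<open>1 + \<beta>\<close>. In the spiked model \<open>x\<^sup>T Y x / \<parallel>x\<parallel>\<^sup>2\<close> is
  \<open>(1 + \<beta> \<parallel>x\<parallel>\<^sup>2) \<chi>\<^sup>2\<^sub>N / N\<close>, which concentrates near \<open>1 + \<beta>\<close>, beyond the level \<open>t\<close>.\<close>

section \<open>Projections of a standard Gaussian vector\<close>

text \<open>Independence means that the joint law is the product of the marginals. The tuple of
  coordinates is the identity map here, so its law is the product measure itself.\<close>

lemma indep_vars_std_gaussian:
  "prob_space.indep_vars (std_gaussian n) (\<lambda>_. borel) (\<lambda>i g. g i) {..<n}"
\<comment> \<open>The product criterion for independence asks for a nonempty index set.\<close>
proof (cases "n = 0")
  case False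
  interpret prob_space "std_gaussian n" by (rule prob_space_std_gaussian)
  let ?D = "density lborel (\<lambda>t. ennreal (std_normal_density t))"
  have rv: "random_variable borel (\<lambda>g. g i)" if "i \<in> {..<n}" for i
    unfolding measurable_cong_sets[OF sets_std_gaussian refl]
    using that by (intro measurable_component_singleton) auto
  have "distr (std_gaussian n) (vec_space n) (\<lambda>g. \<lambda>i\<in>{..<n}. g i)
      = distr (std_gaussian n) (std_gaussian n) (\<lambda>g. g)"
    by (rule distr_cong[OF refl sets_std_gaussian[symmetric]])
       (auto simp: std_gaussian_def space_PiM)
  also have "\<dots> = PiM {..<n} (\<lambda>i. distr (std_gaussian n) borel (\<lambda>g. g i))"
  proof -
    have "distr (std_gaussian n) borel (\<lambda>g. g i) = ?D" if "i \<in> {..<n}" for i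
    proof -
      have "distr (std_gaussian n) borel (\<lambda>g. g i) = distr (std_gaussian n) ?D (\<lambda>g. g i)"
        by (rule distr_cong) auto
      then show ?thesis
        unfolding std_gaussian_def using distr_PiM_component[of "{..<n}" "\<lambda>_. ?D" i] that
        by (simp add: prob_space_normal_density)
    qed
    then have "PiM {..<n} (\<lambda>i. distr (std_gaussian n) borel (\<lambda>g. g i)) = std_gaussian n"
      unfolding std_gaussian_def by (intro PiM_cong) auto
    then show ?thesis by (simp add: distr_id)
  qed
  finally show ?thesis
    using False rv by (subst indep_vars_iff_distr_eq_PiM') auto
next
  case True
  interpret prob_space "std_gaussian n" by (rule prob_space_std_gaussian)
  show ?thesis unfolding indep_vars_def indep_sets_def using True by auto
qed

lemma distributed_std_gaussian_component:
  assumes "i < n"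
  shows "distributed (std_gaussian n) lborel (\<lambda>g. g i) std_normal_density"
proof -
  let ?D = "density lborel (\<lambda>t. ennreal (std_normal_density t))"
  have "distr (std_gaussian n) lborel (\<lambda>g. g i) = distr (std_gaussian n) ?D (\<lambda>g. g i)"
    by (rule distr_cong) auto
  also have "\<dots> = ?D"
    unfolding std_gaussian_def using assms
    by (intro distr_PiM_component prob_space_normal_density) auto
  finally show ?thesis
    using assms by (auto simp: distributed_def measurable_cong_sets[OF sets_std_gaussian refl]
        intro!: measurable_component_singleton)
qed

lemma distributed_dotp_std_gaussian:
  assumes "0 < dotp n v v"
  shows "distributed (std_gaussian n) lborel (dotp n v) (normal_density 0 (sqrt (dotp n v v)))"
proof -
  interpret prob_space "std_gaussian n" by (rule prob_space_std_gaussian)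
  \<comment> \<open>\<open>sum_indep_normal\<close> needs a nonempty index set and positive standard
    deviations \<open>\<bar>v i\<bar>\<close>, so the sum is restricted to the support of
    \<open>v\<close>.\<close>
  define J where "J = {i. i < n \<and> v i \<noteq> 0}"
  have J: "finite J" "J \<subseteq> {..<n}" by (auto simp: J_def)
  have dotp_J: "dotp n v w = (\<Sum>i\<in>J. v i * w i)" for w
    unfolding dotp_def by (rule sum.mono_neutral_right) (auto simp: J_def)
  have "J \<noteq> {}" using assms dotp_J by auto
  have "distributed (std_gaussian n) lborel (\<lambda>g. \<Sum>i\<in>J. v i * g i)
      (normal_density (\<Sum>i\<in>J. 0) (sqrt (\<Sum>i\<in>J. \<bar>v i\<bar>\<^sup>2)))"
  proof (rule sum_indep_normal[OF J(1) \<open>J \<noteq> {}\<close>])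
    show "indep_vars (\<lambda>_. borel) (\<lambda>i g. v i * g i) J"
      by (rule indep_vars_compose2[OF indep_vars_subset[OF indep_vars_std_gaussian J(2)]]) simp
    show "distributed (std_gaussian n) lborel (\<lambda>g. v i * g i) (normal_density 0 \<bar>v i\<bar>)" if "i \<in> J" for i
      using normal_density_affine[OF distributed_std_gaussian_component[of i n], of "v i" 0] that
      by (simp add: J_def)
  qed (simp add: J_def)
  then show ?thesis by (simp add: dotp_J[abs_def] power2_eq_square)
qed

section \<open>Chernoff bound for chi-square tails\<close>

text \<open>Exponential tilting: with this exponent the Gaussian density of variance
  \<open>q\<close> becomes \<open>sqrt t\<close> times the one of variance \<open>t * q\<close>,
  which integrates to 1. The tilt moves the mean of the normalised square to
  \<open>t\<close>.\<close>

lemma nn_integral_exp_dotp_square: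
  assumes q: "0 < dotp n v v" and t: "0 < t"
  shows "(\<integral>\<^sup>+g. ennreal (exp ((1 - 1 / t) / 2 * ((dotp n v g)\<^sup>2 / dotp n v v))) \<partial>std_gaussian n) = ennreal (sqrt t)"
proof -
  define q where "q = dotp n v v"
  have "q > 0" using q by (simp add: q_def)
  have eq: "normal_density 0 (sqrt q) y * exp ((1 - 1 / t) / 2 * (y\<^sup>2 / q))
      = sqrt t * normal_density 0 (sqrt (t * q)) y" for y
    using \<open>q > 0\<close> t
    by (simp add: normal_density_def real_sqrt_mult exp_add[symmetric] field_simps)
  interpret D: prob_space "density lborel (normal_density 0 (sqrt (t * q)))"
    by (rule prob_space_normal_density) (use \<open>q > 0\<close> t in simp)
  have one: "(\<integral>\<^sup>+y. ennreal (normal_density 0 (sqrt (t * q)) y) \<partial>lborel) = 1"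
    using D.emeasure_space_1 by (simp add: emeasure_density)
  have "(\<integral>\<^sup>+g. ennreal (exp ((1 - 1 / t) / 2 * ((dotp n v g)\<^sup>2 / q))) \<partial>std_gaussian n)
    = (\<integral>\<^sup>+y. ennreal (normal_density 0 (sqrt q) y) * ennreal (exp ((1 - 1 / t) / 2 * (y\<^sup>2 / q))) \<partial>lborel)"
    using distributed_dotp_std_gaussian[OF q]
    by (intro distributed_nn_integral[symmetric]) (simp_all add: q_def)
  also have "\<dots> = (\<integral>\<^sup>+y. ennreal (sqrt t) * ennreal (normal_density 0 (sqrt (t * q)) y) \<partial>lborel)"
    by (rule nn_integral_cong)
       (use t eq in \<open>simp only: ennreal_mult'[OF real_sqrt_ge_zero[OF less_imp_le], symmetric]
          ennreal_mult''[OF exp_ge_zero, symmetric]\<close>)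
  also have "\<dots> = ennreal (sqrt t)"
    by (simp add: nn_integral_cmult one)
  finally show ?thesis by (simp add: q_def)
qed

text \<open>The factor \<open>t - 1\<close> makes this the upper tail for \<open>t > 1\<close> and the lower tail for \<open>t < 1\<close>; the
  optimal exponent \<open>(1 - 1 / t) / 2\<close> has the same sign.\<close>

lemma chi_square_tail:
  assumes q: "0 < dotp n v v" and t: "0 < t"
  shows "measure (PiM {..<N} (\<lambda>_. std_gaussian n))
      {G \<in> space (PiM {..<N} (\<lambda>_. std_gaussian n)).
        0 \<le> (t - 1) * ((\<Sum>j<N. (dotp n v (G j))\<^sup>2) - real N * t * dotp n v v)}
    \<le> exp (- (real N / 2 * (t - 1 - ln t)))"
    (is "measure ?P ?E \<le> ?b")
proof -
  define q where "q = dotp n v v"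
  define l where "l = (1 - 1 / t) / 2"
  define W where "W G = (\<Sum>j<N. (dotp n v (G j))\<^sup>2 / q)" for G
  have "q > 0" using q by (simp add: q_def)
  interpret S: prob_space "std_gaussian n" by (rule prob_space_std_gaussian)
  interpret P: prob_space ?P by (intro prob_space_PiM prob_space_std_gaussian)
  interpret product_sigma_finite "\<lambda>_::nat. std_gaussian n" by unfold_locales
  have [measurable]: "dotp n v \<in> borel_measurable (std_gaussian n)"
    using distributed_measurable[OF distributed_dotp_std_gaussian[OF q]] by simp
  have [measurable]: "W \<in> borel_measurable ?P"
    unfolding W_def by measurable
  have W: "(\<Sum>j<N. (dotp n v (G j))\<^sup>2) = q * W G" for G
    using \<open>q > 0\<close> by (simp add: W_def flip: sum_divide_distrib)
  \<comment> \<open>Since \<open>t - 1 = 2 * t * l\<close>, the condition is a positive multiple of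
    \<open>0 \<le> l * W G - l * (real N * t)\<close>. Either tail thus becomes an event to which
    Markov's inequality applies.\<close>
  have E: "0 \<le> (t - 1) * ((\<Sum>j<N. (dotp n v (G j))\<^sup>2) - real N * t * q) \<longleftrightarrow> 1 \<le> ennreal (exp (l * W G - l * (real N * t)))" for G
  proof -
    have "(t - 1) * ((\<Sum>j<N. (dotp n v (G j))\<^sup>2) - real N * t * q) = 2 * q * t * (l * W G - l * (real N * t))"
      using t by (simp add: W l_def field_simps)
    moreover have "0 < 2 * q * t" using \<open>q > 0\<close> t by simp
    from mult_le_cancel_left_pos[OF this, of 0]
    have "0 \<le> 2 * q * t * (l * W G - l * (real N * t)) \<longleftrightarrow> 0 \<le> l * W G - l * (real N * t)"
      by (simp only: mult_zero_right)
    ultimately show ?thesis by (simp only: one_le_exp_iff ennreal_1[symmetric] ennreal_le_iff[OF exp_ge_zero])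
  qed
  have "emeasure ?P ?E = emeasure ?P {G \<in> space ?P. 1 \<le> 1 * ennreal (exp (l * W G - l * (real N * t)))}"
    by (simp add: E flip: q_def)
  also have "\<dots> \<le> 1 * (\<integral>\<^sup>+G. ennreal (exp (l * W G - l * (real N * t))) * indicator (space ?P) G \<partial>?P)"
    by (rule nn_integral_Markov_inequality) auto
  also have "\<dots> = (\<integral>\<^sup>+G. ennreal (exp (- (l * (real N * t)))) * (\<Prod>j<N. ennreal (exp (l * ((dotp n v (G j))\<^sup>2 / q)))) \<partial>?P)"
  proof (unfold mult_1, rule nn_integral_cong)
    fix G assume "G \<in> space ?P"
    moreover have "exp (l * W G - l * (real N * t))
        = exp (- (l * (real N * t))) * (\<Prod>j<N. exp (l * ((dotp n v (G j))\<^sup>2 / q)))"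
      unfolding W_def sum_distrib_left diff_conv_add_uminus exp_add exp_sum[OF finite_lessThan]
      by (rule mult.commute)
    ultimately show "ennreal (exp (l * W G - l * (real N * t))) * indicator (space ?P) G
        = ennreal (exp (- (l * (real N * t)))) * (\<Prod>j<N. ennreal (exp (l * ((dotp n v (G j))\<^sup>2 / q))))"
      by (simp only: prod_ennreal[OF exp_ge_zero] ennreal_mult'[OF exp_ge_zero] indicator_simps mult_1_right)
  qed
  \<comment> \<open>By independence the integral factorises over the samples; each factor is then
    \<open>sqrt t\<close>.\<close>
  also have "\<dots> = ennreal (exp (- (l * (real N * t)))) * (\<Prod>j<N. \<integral>\<^sup>+g. ennreal (exp (l * ((dotp n v g)\<^sup>2 / q))) \<partial>std_gaussian n)"
    by (subst nn_integral_cmult, simp, subst product_nn_integral_prod) simp_all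
  also have "\<dots> = ennreal (exp (- (l * (real N * t))) * sqrt t ^ N)"
    using nn_integral_exp_dotp_square[OF q t] t
    by (simp add: l_def q_def ennreal_power flip: ennreal_mult)
  \<comment> \<open>Uses \<open>l * t = (t - 1) / 2\<close>.\<close>
  also have "exp (- (l * (real N * t))) * sqrt t ^ N = ?b"
  proof -
    have "sqrt t = exp (ln t / 2)" using t by (simp add: ln_sqrt[symmetric])
    then show ?thesis using t by (simp add: l_def field_simps flip: exp_of_nat_mult exp_add)
  qed
  finally show ?thesis
    by (simp add: P.emeasure_eq_measure)
qed

section \<open>Quadratic forms of the sample covariance\<close>

lemma borel_measurable_quadratic_form:
  "(\<lambda>Y. dotp n v (mat_app n Y v)) \<in> borel_measurable (mat_space n n)"
  unfolding dotp_def mat_app_def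
proof (intro borel_measurable_sum borel_measurable_times borel_measurable_const)
  fix i j assume "i \<in> {..<n}" "j \<in> {..<n}"
  then show "(\<lambda>Y. Y i j) \<in> borel_measurable (mat_space n n)"
    by (intro measurable_compose[OF measurable_component_singleton[of i] measurable_component_singleton[of j]]) auto
qed

lemma quadratic_form_sample_cov:
  "dotp n v (mat_app n (sample_cov n N X) v) = (\<Sum>j<N. (dotp n v (X j))\<^sup>2) / real N"
proof -
  have "dotp n v (mat_app n (sample_cov n N X) v)
      = (\<Sum>i<n. \<Sum>k<n. \<Sum>j<N. v i * X j i * (v k * X j k)) / real N"
    by (simp add: dotp_def mat_app_def sample_cov_def sum_distrib_left sum_distrib_right
        sum_divide_distrib algebra_simps)
  also have "(\<Sum>i<n. \<Sum>k<n. \<Sum>j<N. v i * X j i * (v k * X j k))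
      = (\<Sum>i<n. \<Sum>j<N. \<Sum>k<n. v i * X j i * (v k * X j k))"
    by (intro sum.cong refl sum.swap)
  also have "\<dots> = (\<Sum>j<N. \<Sum>i<n. \<Sum>k<n. v i * X j i * (v k * X j k))"
    by (rule sum.swap)
  also have "\<dots> = (\<Sum>j<N. (dotp n v (X j))\<^sup>2)"
    by (simp add: dotp_def power2_eq_square sum_product)
  finally show ?thesis .
qed

text \<open>The square root of the covariance is symmetric, so it can be moved from the Gaussian
  columns onto the direction \<open>v\<close>.\<close>

lemma quadratic_form_spiked_sample_cov:
  assumes "0 \<le> 1 + \<beta> * (L2_set x {..<n})\<^sup>2"
  shows "dotp n v (mat_app n (sample_cov n N
      (\<lambda>k\<in>{..<N}. \<lambda>i\<in>{..<n}. \<Sum>j<n. spiked_sqrt n \<beta> x i j * G k j)) v)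
    = (\<Sum>j<N. (dotp n (mat_app n (spiked_sqrt n \<beta> x) v) (G j))\<^sup>2) / real N"
proof -
  have "dotp n v (\<lambda>i\<in>{..<n}. \<Sum>j<n. spiked_sqrt n \<beta> x i j * g j)
      = dotp n (mat_app n (spiked_sqrt n \<beta> x) v) g" for g
    unfolding dotp_sym[OF psd_spiked_sqrt[OF assms], symmetric]
    by (simp add: dotp_def mat_app_def)
  then show ?thesis by (simp add: quadratic_form_sample_cov)
qed

text \<open>The first assumption rules out the failure branch, so events pull back to standard
  Gaussian columns \<open>G\<close>, where the tail bound lives.\<close>

lemma measure_wishart_given_spike:
  assumes "0 \<le> 1 + \<beta> * (L2_set x {..<n})\<^sup>2" "Measurable.pred (outcome_space n) R"
  shows "measure (wishart_given_spike n N \<beta> x) {y \<in> space (outcome_space n). R y}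
    = measure (PiM {..<N} (\<lambda>_. std_gaussian n)) {G \<in> space (PiM {..<N} (\<lambda>_. std_gaussian n)).
        R (Some (sample_cov n N (\<lambda>k\<in>{..<N}. \<lambda>i\<in>{..<n}. \<Sum>j<n. spiked_sqrt n \<beta> x i j * G k j)))}"
proof -
  have no_fail: "\<not> (\<beta> < 0 \<and> 1 < \<bar>\<beta>\<bar> * (L2_set x {..<n})\<^sup>2)"
    using assms(1) by auto
  have "(\<lambda>G. \<lambda>k\<in>{..<N}. \<lambda>i\<in>{..<n}. \<Sum>j<n. spiked_sqrt n \<beta> x i j * G k j)
      \<in> measurable (PiM {..<N} (\<lambda>_. std_gaussian n)) (mat_space N n)"
  proof (rule measurable_restrict)
    fix k assume "k \<in> {..<N}"
    then show "(\<lambda>G. \<lambda>i\<in>{..<n}. \<Sum>j<n. spiked_sqrt n \<beta> x i j * G k j)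
        \<in> measurable (PiM {..<N} (\<lambda>_. std_gaussian n)) (vec_space n)"
      by measurable
  qed
  then have m: "(\<lambda>G. Some (sample_cov n N (\<lambda>k\<in>{..<N}. \<lambda>i\<in>{..<n}. \<Sum>j<n. spiked_sqrt n \<beta> x i j * G k j)))
      \<in> measurable (PiM {..<N} (\<lambda>_. std_gaussian n)) (outcome_space n)"
    by measurable
  show ?thesis
    unfolding wishart_given_spike_eq if_not_P[OF no_fail]
    using measurable_space[OF m] assms(2)
    by (subst measure_distr[OF m]) (auto simp: pred_def intro!: arg_cong[where f = "measure _"])
qed

lemma sets_wishart_given_spike: "sets (wishart_given_spike n N \<beta> x) = sets (outcome_space n)"
  by (simp add: wishart_given_spike_def)

section \<open>The scan test and its errors for a fixed spike\<close>

text \<open>The factor \<open>\<beta>\<close> orients the comparison, so one formula covers both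
  signs. The failure symbol counts as spiked because the unspiked model never emits it.\<close>

definition spike_test :: "real \<Rightarrow> real \<Rightarrow> nat \<Rightarrow> (nat \<Rightarrow> real) set \<Rightarrow> (nat \<Rightarrow> nat \<Rightarrow> real) option \<Rightarrow> bool" where
  "spike_test \<beta> t n A y \<longleftrightarrow>
     (case y of None \<Rightarrow> True
      | Some Y \<Rightarrow> \<exists>v\<in>A. 0 \<le> \<beta> * (dotp n v (mat_app n Y v) - t * dotp n v v))"

lemma measurable_spike_test:
  assumes "finite A"
  shows "Measurable.pred (outcome_space n) (spike_test \<beta> t n A)"
proof -
  have "Some -` {y \<in> space (outcome_space n). spike_test \<beta> t n A y} \<inter> space (mat_space n n)
      = (\<Union>v\<in>A. {Y \<in> space (mat_space n n). 0 \<le> \<beta> * (dotp n v (mat_app n Y v) - t * dotp n v v)})"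
    by (auto simp: spike_test_def)
  moreover have "\<dots> \<in> sets (mat_space n n)"
    using assms
    by (intro sets.finite_UN borel_measurable_le borel_measurable_times borel_measurable_diff
        borel_measurable_const borel_measurable_quadratic_form)
  ultimately show ?thesis
    by (auto simp: pred_def sets_option_measure)
qed

text \<open>Union bound over the scanned directions. As \<open>t - 1 = \<beta> * \<delta>\<close>
  has the sign of \<open>\<beta>\<close>, a detection in one direction is a tail event of
  \<open>chi_square_tail\<close>.\<close>

lemma type_I_error_le:
  assumes A: "finite A" "\<And>v. v \<in> A \<Longrightarrow> 0 < dotp n v v"
    and t: "t = 1 + \<beta> * \<delta>" "0 < t" "0 < \<delta>"
  shows "\<P>(y in unspiked_wishart n N. spike_test \<beta> t n A y)
    \<le> real (card A) * exp (- (real N / 2 * (t - 1 - ln t)))"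
proof -
  let ?P = "PiM {..<N} (\<lambda>_. std_gaussian n)"
  interpret P: prob_space ?P by (intro prob_space_PiM prob_space_std_gaussian)
  define E where "E v = {G \<in> space ?P.
    0 \<le> (t - 1) * ((\<Sum>j<N. (dotp n v (G j))\<^sup>2) - real N * t * dotp n v v)}" for v
  have E: "E v \<in> sets ?P" if "v \<in> A" for v
  proof -
    have [measurable]: "dotp n v \<in> borel_measurable (std_gaussian n)"
      using distributed_measurable[OF distributed_dotp_std_gaussian[OF A(2)[OF that]]] by simp
    show ?thesis unfolding E_def by measurable
  qed
  have app: "dotp n (mat_app n (spiked_sqrt n 0 (\<lambda>_. 0)) v) = dotp n v" for v
    by (simp add: fun_eq_iff dotp_def spiked_sqrt_def mat_app_spiked_cov)
  have "\<P>(y in unspiked_wishart n N. spike_test \<beta> t n A y)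
    = measure (wishart_given_spike n N 0 (\<lambda>_. 0)) {y \<in> space (outcome_space n). spike_test \<beta> t n A y}"
    by (simp only: unspiked_wishart_def sets_eq_imp_space_eq[OF sets_wishart_given_spike])
  also have "\<dots> = measure ?P {G \<in> space ?P. \<exists>v\<in>A.
      0 \<le> \<beta> * ((\<Sum>j<N. (dotp n v (G j))\<^sup>2) / real N - t * dotp n v v)}"
    by (subst measure_wishart_given_spike[OF _ measurable_spike_test[OF A(1)]])
       (simp_all add: spike_test_def quadratic_form_spiked_sample_cov app del: mult_zero_left)
  also have "\<dots> \<le> measure ?P (\<Union>v\<in>A. E v)"
  proof (rule P.finite_measure_mono)
    \<comment> \<open>For \<open>N = 0\<close> the quotient is 0 by convention and the empty sum
      makes \<open>W\<close> vanish, so the identity below still holds.\<close>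
    have "0 \<le> (t - 1) * (W - real N * t * q)" if "0 \<le> \<beta> * (W / real N - t * q)" "N = 0 \<Longrightarrow> W = 0" for W q
    proof -
      have "(t - 1) * (W - real N * t * q) = (real N * \<delta>) * (\<beta> * (W / real N - t * q))"
        using that(2) by (cases "N = 0") (simp_all add: t(1) field_simps)
      then show ?thesis using that(1) t(3) by simp
    qed
    then show "{G \<in> space ?P. \<exists>v\<in>A. 0 \<le> \<beta> * ((\<Sum>j<N. (dotp n v (G j))\<^sup>2) / real N - t * dotp n v v)}
        \<subseteq> (\<Union>v\<in>A. E v)"
      unfolding E_def by fastforce
  qed (use A(1) E in auto)
  also have "\<dots> \<le> (\<Sum>v\<in>A. measure ?P (E v))"
    by (rule measure_UNION_le[OF A(1) E])
  also have "\<dots> \<le> (\<Sum>v\<in>A. exp (- (real N / 2 * (t - 1 - ln t))))"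
    unfolding E_def by (intro sum_mono chi_square_tail A t)
  finally show ?thesis by simp
qed

text \<open>A miss on all of \<open>A\<close> is in particular a miss in the direction
  \<open>x\<close>, where the form is \<open>1 + \<beta> * q\<close> times a chi-square average.
  Since \<open>q\<close> is at least \<open>\<delta>'\<close>, that factor lies at or beyond
  \<open>s\<close> as seen from 1, so a miss forces the average past the relative level
  \<open>t / s\<close>, uniformly in \<open>x\<close>.\<close>

lemma type_II_error_given_spike_le:
  assumes A: "finite A" "x \<in> A"
    and t: "t = 1 + \<beta> * \<delta>" "0 < t" "s = 1 + \<beta> * \<delta>'" "0 < s" "0 < \<delta>" "\<delta> < \<delta>'"
    and q: "\<delta>' \<le> dotp n x x" "0 < 1 + \<beta> * dotp n x x"
  shows "measure (wishart_given_spike n N \<beta> x) {y \<in> space (outcome_space n). \<not> spike_test \<beta> t n A y}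
    \<le> exp (- (real N / 2 * (t / s - 1 - ln (t / s))))"
proof -
  let ?P = "PiM {..<N} (\<lambda>_. std_gaussian n)"
  let ?S = "mat_app n (spiked_sqrt n \<beta> x)"
  define q where "q = dotp n x x"
  have q': "0 < q" "\<delta>' \<le> q" "0 < 1 + \<beta> * q" using q t by (auto simp: q_def)
  have nonneg: "0 \<le> 1 + \<beta> * (L2_set x {..<n})\<^sup>2"
    using q(2) by (simp add: dotp_L2)
  interpret P: prob_space ?P by (intro prob_space_PiM prob_space_std_gaussian)
  define E where "E = {G \<in> space ?P.
    0 \<le> (t / s - 1) * ((\<Sum>j<N. (dotp n x (G j))\<^sup>2) - real N * (t / s) * q)}"
  have E: "E \<in> sets ?P"
  proof -
    have [measurable]: "dotp n x \<in> borel_measurable (std_gaussian n)"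
      using distributed_measurable[OF distributed_dotp_std_gaussian[of n x]] q'(1) by (simp add: q_def)
    show ?thesis unfolding E_def by measurable
  qed
  \<comment> \<open>The spike is an eigenvector of the square root.\<close>
  have "?S x i = sqrt (1 + \<beta> * q) * x i" if "i < n" for i
  proof -
    have "?S x i = x i + (sqrt (1 + \<beta> * q) - 1) / q * q * x i"
      using that by (simp only: spiked_sqrt_def mat_app_spiked_cov q_def dotp_L2)
    also have "(sqrt (1 + \<beta> * q) - 1) / q * q = sqrt (1 + \<beta> * q) - 1" using q'(1) by simp
    finally show ?thesis by (simp add: left_diff_distrib)
  qed
  then have "dotp n (?S x) g = sqrt (1 + \<beta> * q) * dotp n x g" for g
    by (simp add: dotp_def sum_distrib_left mult.assoc)
  then have app: "(dotp n (?S x) g)\<^sup>2 = (1 + \<beta> * q) * (dotp n x g)\<^sup>2" for g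
    using q'(3) by (simp add: power_mult_distrib)
  have "measure (wishart_given_spike n N \<beta> x) {y \<in> space (outcome_space n). \<not> spike_test \<beta> t n A y}
    = measure ?P {G \<in> space ?P. \<not> (\<exists>v\<in>A. 0 \<le> \<beta> * ((\<Sum>j<N. (dotp n (?S v) (G j))\<^sup>2) / real N - t * dotp n v v))}"
    by (subst measure_wishart_given_spike[OF nonneg pred_intros_logic(2)[OF measurable_spike_test[OF A(1)]]])
       (simp add: spike_test_def quadratic_form_spiked_sample_cov[OF nonneg])
  also have "\<dots> \<le> measure ?P E"
  proof (rule P.finite_measure_mono)
    have *: "0 \<le> (t / s - 1) * (W - real N * (t / s) * q)"
      if "\<not> 0 \<le> \<beta> * ((1 + \<beta> * q) * W / real N - t * q)" "0 \<le> W" "N = 0 \<Longrightarrow> W = 0" for W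
    proof (cases "N = 0")
      case False
      \<comment> \<open>Replacing \<open>1 + \<beta> * q\<close> by \<open>s\<close> subtracts a
        multiple of \<open>\<beta>\<^sup>2\<close>, so the expression only decreases, whatever the
        sign of \<open>\<beta>\<close>.\<close>
      have "\<beta> * (s * W / real N - t * q)
          = \<beta> * ((1 + \<beta> * q) * W / real N - t * q) - \<beta>\<^sup>2 * (q - \<delta>') * W / real N"
        using False by (simp add: t(3) field_simps power2_eq_square)
      also have "\<dots> \<le> 0"
      proof -
        have "0 \<le> \<beta>\<^sup>2 * (q - \<delta>') * W / real N" using q'(2) that(2) by simp
        then show ?thesis using that(1) by linarith
      qed
      \<comment> \<open>The positive multiplier is chosen to produce the factor
        \<open>t / s - 1 = \<beta> * (\<delta> - \<delta>') / s\<close>. Its sign is opposite to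
        that of \<open>\<beta>\<close>: a miss is a lower tail for positive \<open>\<beta>\<close>
        and an upper tail for negative \<open>\<beta>\<close>.\<close>
      finally have "0 \<le> (real N * (\<delta>' - \<delta>) / s\<^sup>2) * - (\<beta> * (s * W / real N - t * q))"
        using t by (intro mult_nonneg_nonneg) auto
      also have "\<dots> = \<beta> * (\<delta> - \<delta>') / s * (W - real N * (t / s) * q)"
        using False t(4) by (simp add: field_simps power2_eq_square)
      also have "\<beta> * (\<delta> - \<delta>') / s = t / s - 1"
        using t(4) by (simp add: field_simps) (simp add: t algebra_simps)
      finally show ?thesis .
    qed (use that t(4) in \<open>simp_all\<close>)
    show "{G \<in> space ?P. \<not> (\<exists>v\<in>A. 0 \<le> \<beta> * ((\<Sum>j<N. (dotp n (?S v) (G j))\<^sup>2) / real N - t * dotp n v v))} \<subseteq> E"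
    proof (unfold E_def, intro Collect_mono impI conjI)
      fix G
      assume G: "G \<in> space ?P \<and> \<not> (\<exists>v\<in>A. 0 \<le> \<beta> * ((\<Sum>j<N. (dotp n (?S v) (G j))\<^sup>2) / real N - t * dotp n v v))"
      then have "\<not> 0 \<le> \<beta> * ((\<Sum>j<N. (dotp n (?S x) (G j))\<^sup>2) / real N - t * q)"
        using A(2) by (auto simp: q_def)
      then show "0 \<le> (t / s - 1) * ((\<Sum>j<N. (dotp n x (G j))\<^sup>2) - real N * (t / s) * q)"
        by (intro *) (simp_all add: app sum_nonneg sum_distrib_left)
    qed auto
  qed (rule E)
  also have "\<dots> \<le> exp (- (real N / 2 * (t / s - 1 - ln (t / s))))"
    unfolding E_def q_def using q'(1) t by (intro chi_square_tail) (simp_all add: q_def)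
  finally show ?thesis .
qed

section \<open>Averaging over the prior\<close>

text \<open>A mixture averages the conditional probabilities; on the exceptional set
  \<open>C\<close> these are bounded by 1, which costs at most the prior mass of
  \<open>C\<close>.\<close>

lemma measure_spiked_wishart_le:
  assumes P: "prob_space P" "sets P = sets (vec_space n)" and "0 \<le> b"
    and B: "B \<in> sets (outcome_space n)" and C: "C \<in> sets P"
    and K: "AE x in P. x \<notin> C \<longrightarrow> measure (wishart_given_spike n N \<beta> x) B \<le> b"
  shows "measure (spiked_wishart n N \<beta> P) B \<le> b + measure P C"
proof -
  interpret P: prob_space P by fact
  have [measurable]: "B \<in> sets (outcome_space n)" "C \<in> sets P" by fact+
  have P': "P \<in> space (prob_algebra (vec_space n))"
    using P by (simp add: space_prob_algebra)
  have prob: "prob_space (wishart_given_spike n N \<beta> x)" if "x \<in> space P" for x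
    using measurable_space[OF measurable_wishart_given_spike] that sets_eq_imp_space_eq[OF P(2)]
    by (auto simp: space_prob_algebra)
  have bound: "AE x in P. emeasure (wishart_given_spike n N \<beta> x) B \<le> ennreal b + indicator C x"
    using K AE_space
  proof eventually_elim
    case (elim x)
    then interpret W: prob_space "wishart_given_spike n N \<beta> x" by (intro prob)
    show ?case
    proof (cases "x \<in> C")
      case True
      then show ?thesis using W.measure_le_1[of B] by (auto intro: add_increasing)
    next
      case False
      then show ?thesis using elim by (simp add: W.emeasure_eq_measure ennreal_leI)
    qed
  qed
  interpret W: prob_space "spiked_wishart n N \<beta> P"
    using spiked_wishart_in_prob_algebra[OF P] by (simp add: space_prob_algebra)
  have "emeasure (spiked_wishart n N \<beta> P) B = (\<integral>\<^sup>+x. emeasure (wishart_given_spike n N \<beta> x) B \<partial>P)"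
    unfolding spiked_wishart_def
    by (rule emeasure_bind_prob_algebra[OF P' measurable_wishart_given_spike B])
  also have "\<dots> \<le> (\<integral>\<^sup>+x. ennreal b + indicator C x \<partial>P)"
    using bound by (rule nn_integral_mono_AE)
  also have "\<dots> = ennreal (b + measure P C)"
    using \<open>0 \<le> b\<close> by (simp add: nn_integral_add P.emeasure_eq_measure P.prob_space)
  finally show ?thesis
    using \<open>0 \<le> b\<close> by (simp add: W.emeasure_eq_measure flip: ennreal_plus)
qed

lemma sub_one_sub_ln_pos:
  fixes t :: real
  assumes "0 < t" "t \<noteq> 1"
  shows "0 < t - 1 - ln t"
  using ln_le_minus_one[OF assms(1)] ln_eq_minus_one[OF assms(1)] assms(2) by fastforce

lemma tendsto_exp_uminus_at_top:
  fixes f :: "'a \<Rightarrow> real"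
  assumes "filterlim f at_top F"
  shows "((\<lambda>x. exp (- f x)) \<longlongrightarrow> 0) F"
  by (rule filterlim_compose[OF exp_at_bot]) (use assms in \<open>simp add: filterlim_uminus_at_top\<close>)

section \<open>Consistency of the scan test\<close>

theorem theorem5p3:
  fixes \<gamma> \<beta> c :: real
    and X :: "nat \<Rightarrow> (nat \<Rightarrow> real) measure"
    and N :: "nat \<Rightarrow> nat"
  assumes "\<gamma> > 0"
    and "\<beta> > -1"
    and "(\<lambda>n. real n / real (N n)) \<longlonglongrightarrow> \<gamma>"
    and "spike_prior X"
    and "c > 0"
    and "\<And>n. supported_on_at_most (X n) (c ^ n)"
    and "2 * \<gamma> * ln c < \<beta> - ln (1 + \<beta>)"
  shows "\<exists>T. consistently_distinguishes outcome_space T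
           (\<lambda>n. spiked_wishart n (N n) \<beta> (X n)) (\<lambda>n. unspiked_wishart n (N n))"
proof -
  have X: "prob_space (X n)" "sets (X n) = sets (vec_space n)"
    and X_norm: "\<epsilon> > 0 \<Longrightarrow> (\<lambda>n. \<P>(x in X n. \<bar>L2_set x {..<n} - 1\<bar> > \<epsilon>)) \<longlonglongrightarrow> 0" for n \<epsilon>
    using assms(4) by (auto simp: spike_prior_def)
  have "\<forall>n. \<exists>A. finite A \<and> real (card A) \<le> c ^ n \<and> (AE x in X n. x \<in> A)"
    using assms(6) by (simp add: supported_on_at_most_def)
  then obtain A where A: "finite (A n)" "real (card (A n)) \<le> c ^ n" "AE x in X n. x \<in> A n" for n
    by metis
  \<comment> \<open>For \<open>\<beta> = 0\<close> the gap condition forces \<open>c < 1\<close>, so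
    the support for \<open>n = 1\<close> would have fewer than one point, impossible for a
    probability measure.\<close>
  have "\<beta> \<noteq> 0"
  proof
    assume "\<beta> = 0"
    interpret prob_space "X 1" by (rule X)
    have "c < 1" using assms(1,5,7) \<open>\<beta> = 0\<close> by (simp add: mult_less_0_iff)
    then have "real (card (A 1)) < 1" using A(2)[of 1] by simp
    then have "A 1 = {}" using A(1)[of 1] by simp
    then show False using A(3)[of 1] AE_False by simp
  qed
  \<comment> \<open>At \<open>\<delta> = 1\<close> the level would be \<open>1 + \<beta>\<close>
    itself. The gap condition is strict, so by continuity it survives for some
    \<open>\<delta>\<close> below 1, which leaves room for the type II bound.\<close>
  have "eventually (\<lambda>\<delta>. 2 * \<gamma> * ln c < \<beta> * \<delta> - ln (1 + \<beta> * \<delta>) \<and> \<delta> \<in> {0<..<1}) (at_left 1)"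
  proof (rule eventually_conj)
    have "((\<lambda>\<delta>. \<beta> * \<delta> - ln (1 + \<beta> * \<delta>)) \<longlongrightarrow> \<beta> * 1 - ln (1 + \<beta> * 1)) (at_left 1)"
      using assms(2) by (intro tendsto_intros) auto
    then show "eventually (\<lambda>\<delta>. 2 * \<gamma> * ln c < \<beta> * \<delta> - ln (1 + \<beta> * \<delta>)) (at_left 1)"
      by (rule order_tendstoD) (use assms(7) in simp)
    show "eventually (\<lambda>\<delta>. \<delta> \<in> {0<..<1::real}) (at_left 1)"
      by (rule eventually_at_leftI[of 0]) auto
  qed
  then obtain \<delta> where \<delta>: "2 * \<gamma> * ln c < \<beta> * \<delta> - ln (1 + \<beta> * \<delta>)" "0 < \<delta>" "\<delta> < 1"
    using eventually_happens'[OF trivial_limit_at_left_real] by force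
  \<comment> \<open>\<open>s\<close> separates the test level \<open>t\<close> from the spiked value \<open>1 + \<beta> \<parallel>x\<parallel>\<^sup>2\<close>, uniformly over norms near \<open>1\<close>.\<close>
  define \<delta>' where "\<delta>' = (\<delta> + 1) / 2"
  have \<delta>': "\<delta> < \<delta>'" "\<delta>' < 1" using \<delta> by (simp_all add: \<delta>'_def)
  define t where "t = 1 + \<beta> * \<delta>"
  define s where "s = 1 + \<beta> * \<delta>'"
  have pos: "0 < 1 + \<beta> * d" if "0 < d" "d < 1" for d
  proof -
    have "0 < d * (1 + \<beta>)" using that(1) assms(2) by (intro mult_pos_pos) auto
    then show ?thesis using that(2) by (simp add: algebra_simps)
  qed
  have "0 < t" "0 < s" using pos \<delta> \<delta>' by (simp_all add: t_def s_def)
  \<comment> \<open>Here \<open>\<beta> \<noteq> 0\<close> enters: it makes the type II exponent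
    \<open>g2\<close> positive.\<close>
  have "t / s \<noteq> 1" using \<delta>'(1) \<open>\<beta> \<noteq> 0\<close> \<open>0 < s\<close> by (simp add: t_def s_def)
  define g1 where "g1 = t - 1 - ln t"
  define g2 where "g2 = t / s - 1 - ln (t / s)"
  have g1: "2 * \<gamma> * ln c < g1" using \<delta>(1) by (simp add: g1_def t_def)
  have g2: "0 < g2"
    unfolding g2_def using \<open>0 < t\<close> \<open>0 < s\<close> \<open>t / s \<noteq> 1\<close> by (intro sub_one_sub_ln_pos) auto
  have "eventually (\<lambda>u. \<delta>' < u\<^sup>2 \<and> 0 < 1 + \<beta> * u\<^sup>2) (nhds (1::real))"
  proof (rule eventually_conj)
    have sq: "((\<lambda>u::real. u\<^sup>2) \<longlongrightarrow> 1\<^sup>2) (nhds 1)"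
      by (rule tendsto_power[OF filterlim_ident])
    then show "eventually (\<lambda>u. \<delta>' < u\<^sup>2) (nhds (1::real))"
      by (rule order_tendstoD) (use \<delta>' in simp)
    have "((\<lambda>u::real. 1 + \<beta> * u\<^sup>2) \<longlongrightarrow> 1 + \<beta> * 1\<^sup>2) (nhds 1)"
      by (rule tendsto_add[OF tendsto_const tendsto_mult[OF tendsto_const sq]])
    then show "eventually (\<lambda>u. 0 < 1 + \<beta> * u\<^sup>2) (nhds (1::real))"
      by (rule order_tendstoD) (use assms(2) in simp)
  qed
  then obtain d where d: "0 < d" "\<And>u::real. dist u 1 < d \<Longrightarrow> \<delta>' < u\<^sup>2 \<and> 0 < 1 + \<beta> * u\<^sup>2"
    by (metis (mono_tags, lifting) eventually_nhds_metric)
  \<comment> \<open>Halving \<open>d\<close> puts the closed window used in \<open>A'\<close> inside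
    the open ball of radius \<open>d\<close>.\<close>
  define \<epsilon> where "\<epsilon> = d / 2"
  \<comment> \<open>Only points of typical norm are scanned. This discards the zero vector, at which
    the test condition holds for every matrix, and keeps the cardinality bound.\<close>
  define A' where "A' n = {x \<in> A n. \<bar>L2_set x {..<n} - 1\<bar> \<le> \<epsilon>}" for n
  have "0 < \<epsilon>" using d(1) by (simp add: \<epsilon>_def)
  have A': "finite (A' n)" "real (card (A' n)) \<le> c ^ n" for n
    using A(1,2)[of n] card_mono[of "A n" "A' n"] by (auto simp: A'_def)
  have A'_norm: "\<delta>' < dotp n x x \<and> 0 < 1 + \<beta> * dotp n x x" if "x \<in> A' n" for n x
    using d(2)[of "L2_set x {..<n}"] that d(1) by (simp add: A'_def \<epsilon>_def dist_real_def dotp_L2)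
  define T where "T n = spike_test \<beta> t n (A' n)" for n
  have T: "Measurable.pred (outcome_space n) (T n)" for n
    unfolding T_def by (rule measurable_spike_test[OF A'(1)])
  define C where "C n = {x \<in> space (X n). \<bar>L2_set x {..<n} - 1\<bar> > \<epsilon>}" for n
  define e1 where "e1 n = c ^ n * exp (- (real (N n) / 2 * g1))" for n
  define e2 where "e2 n = exp (- (real (N n) / 2 * g2))" for n
  have type_I: "\<P>(y in unspiked_wishart n (N n). T n y) \<le> e1 n" for n
  proof -
    have "\<P>(y in unspiked_wishart n (N n). T n y) \<le> real (card (A' n)) * exp (- (real (N n) / 2 * g1))"
      unfolding T_def g1_def
      using A'_norm \<delta> \<delta>' \<open>0 < t\<close>
      by (intro type_I_error_le[OF A'(1) _ t_def]) (auto intro: less_trans dest: A'_norm)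
    also have "\<dots> \<le> e1 n" unfolding e1_def by (intro mult_right_mono A') auto
    finally show ?thesis .
  qed
  have type_II: "\<P>(y in spiked_wishart n (N n) \<beta> (X n). \<not> T n y) \<le> e2 n + measure (X n) (C n)" for n
  proof -
    have sp: "space (spiked_wishart n (N n) \<beta> (X n)) = space (outcome_space n)"
      using spiked_wishart_in_prob_algebra[OF X]
      by (intro sets_eq_imp_space_eq) (simp add: space_prob_algebra)
    have [measurable]: "(\<lambda>x. \<Sum>i<n. (x i)\<^sup>2) \<in> borel_measurable (X n)"
      unfolding measurable_cong_sets[OF X(2) refl]
      by (intro borel_measurable_sum borel_measurable_power measurable_component_singleton) auto
    have C: "C n \<in> sets (X n)" unfolding C_def L2_set_def by measurable
    have "AE x in X n. x \<notin> C n \<longrightarrow>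
        measure (wishart_given_spike n (N n) \<beta> x) {y \<in> space (outcome_space n). \<not> T n y} \<le> e2 n"
      using A(3)[of n] AE_space
    proof eventually_elim
      case (elim x)
      show ?case
      proof
        assume "x \<notin> C n"
        \<comment> \<open>Almost every spike lies in the support, so one of typical norm is itself
          among the scanned directions.\<close>
        then have x: "x \<in> A' n" using elim by (auto simp: A'_def C_def)
        then show "measure (wishart_given_spike n (N n) \<beta> x) {y \<in> space (outcome_space n). \<not> T n y} \<le> e2 n"
          unfolding T_def e2_def g2_def using A'_norm[OF x] \<delta> \<delta>' \<open>0 < t\<close> \<open>0 < s\<close>
          by (intro type_II_error_given_spike_le[OF A'(1) x t_def _ s_def]) auto
      qed
    qed
    moreover have "{y \<in> space (outcome_space n). \<not> T n y} \<in> sets (outcome_space n)"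
      using pred_intros_logic(2)[OF T[of n]] unfolding pred_def .
    ultimately show ?thesis
      unfolding sp by (intro measure_spiked_wishart_le X C) (simp_all only: e2_def exp_ge_zero)
  qed

  \<comment> \<open>Limits of the error bounds\<close>
  \<comment> \<open>The lower end excludes \<open>N n = 0\<close>, where the quotient is 0 by
    convention; the upper end, any constant above \<open>\<gamma>\<close>, makes \<open>N n\<close>
    grow at least linearly.\<close>
  have "eventually (\<lambda>n. real n / real (N n) \<in> {0<..<2 * \<gamma>}) sequentially"
    using eventually_conj[OF order_tendstoD(1)[OF assms(3), of 0] order_tendstoD(2)[OF assms(3), of "2 * \<gamma>"]] assms(1)
    by simp
  then have ev: "eventually (\<lambda>n. 0 < N n \<and> real n / (2 * \<gamma>) \<le> real (N n)) sequentially"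
  proof eventually_elim
    case (elim n)
    then have "0 < N n" by (cases "N n = 0") auto
    then show ?case using elim assms(1) by (simp add: field_simps)
  qed
  have N_top: "filterlim (\<lambda>n. real (N n)) at_top sequentially"
  proof (rule filterlim_at_top_mono)
    show "filterlim (\<lambda>n. real n / (2 * \<gamma>)) at_top sequentially"
      using filterlim_tendsto_pos_mult_at_top[OF tendsto_const[of "1 / (2 * \<gamma>)"] _ filterlim_real_sequentially] assms(1)
      by simp
    show "eventually (\<lambda>n. real n / (2 * \<gamma>) \<le> real (N n)) sequentially"
      using ev by (rule eventually_mono) blast
  qed
  have "e1 \<longlonglongrightarrow> 0"
  proof -
    \<comment> \<open>Once \<open>N n > 0\<close>, the count \<open>c ^ n\<close> enters the
      exponent as \<open>(real n / real (N n) * ln c) * real (N n)\<close>. The remaining rate has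
      limit \<open>g1 / 2 - \<gamma> * ln c\<close>, positive by the choice of
      \<open>\<delta>\<close>.\<close>
    have "(\<lambda>n. g1 / 2 - real n / real (N n) * ln c) \<longlonglongrightarrow> g1 / 2 - \<gamma> * ln c"
      by (intro tendsto_intros assms(3))
    then have "filterlim (\<lambda>n. (g1 / 2 - real n / real (N n) * ln c) * real (N n)) at_top sequentially"
      by (rule filterlim_tendsto_pos_mult_at_top) (use g1 N_top in auto)
    then have "(\<lambda>n. exp (- ((g1 / 2 - real n / real (N n) * ln c) * real (N n)))) \<longlonglongrightarrow> 0"
      by (rule tendsto_exp_uminus_at_top)
    then show ?thesis
    proof (rule Lim_transform_eventually)
      show "eventually (\<lambda>n. exp (- ((g1 / 2 - real n / real (N n) * ln c) * real (N n))) = e1 n) sequentially"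
        using ev
      proof eventually_elim
        case (elim n)
        have "c ^ n = exp (real n * ln c)" using assms(5) by (simp add: exp_of_nat_mult)
        then show ?case using elim by (simp add: e1_def field_simps flip: exp_add)
      qed
    qed
  qed
  moreover have "e2 \<longlonglongrightarrow> 0"
  proof -
    have "filterlim (\<lambda>n. g2 / 2 * real (N n)) at_top sequentially"
      by (rule filterlim_tendsto_pos_mult_at_top[OF tendsto_const _ N_top]) (use g2 in simp)
    then have "(\<lambda>n. exp (- (g2 / 2 * real (N n)))) \<longlonglongrightarrow> 0"
      by (rule tendsto_exp_uminus_at_top)
    then show ?thesis by (simp add: e2_def[abs_def] mult.commute)
  qed
  moreover have "(\<lambda>n. measure (X n) (C n)) \<longlonglongrightarrow> 0"
    unfolding C_def by (rule X_norm[OF \<open>0 < \<epsilon>\<close>])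
  ultimately have lim: "(\<lambda>n. e1 n + (e2 n + measure (X n) (C n))) \<longlonglongrightarrow> 0"
    using tendsto_add[of e1 0 sequentially "\<lambda>n. e2 n + measure (X n) (C n)" 0]
      tendsto_add[of e2 0 sequentially "\<lambda>n. measure (X n) (C n)" 0] by simp
  have "(\<lambda>n. \<P>(y in unspiked_wishart n (N n). T n y)
      + \<P>(y in spiked_wishart n (N n) \<beta> (X n). \<not> T n y)) \<longlonglongrightarrow> 0"
  proof (rule tendsto_sandwich[OF _ _ tendsto_const lim]; intro always_eventually allI)
    fix n
    show "0 \<le> \<P>(y in unspiked_wishart n (N n). T n y) + \<P>(y in spiked_wishart n (N n) \<beta> (X n). \<not> T n y)"
      by (intro add_nonneg_nonneg measure_nonneg)
    show "\<P>(y in unspiked_wishart n (N n). T n y) + \<P>(y in spiked_wishart n (N n) \<beta> (X n). \<not> T n y)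
        \<le> e1 n + (e2 n + measure (X n) (C n))"
      by (rule add_mono[OF type_I type_II])
  qed
  then show ?thesis
    unfolding consistently_distinguishes_def using T by blast
qed

end
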